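(* For $e\in\{1,2,3,4\}$ and for any $e$-power factoradic fixed point $p$ of $S_{e,!}$, there exist arbitrarily long sequences of consecutive $e$-power factoradic $p$-happy numbers.
   Context: Every positive integer $n$ has a unique factoradic (factorial base) representation $n=\sum_{i=1}^k a_i\cdot i!$ with $a_k\neq 0$ and $0\leq a_i\leq i$ for $1\leq i\leq k$. For an integer $e\geq 1$, the $e$-power factoradic happy function $S_{e,!}:\mathbb{Z}_{\geq 0}\to\mathbb{Z}_{\geq 0}$ is defined by $S_{e,!}(0)=0$ and $S_{e,!}(n)=\sum_{i=1}^k a_i^e$ for $n\geq 1$; $S_{e,!}^\ell$ denotes the $\ell$-th iterate, with $S_{e,!}^0(n)=n$. A positive integer $p$ with $S_{e,!}(p)=p$ is an $e$-power factoradic fixed point. Given such a $p$, a positive integer $x$ is an $e$-power factoradic $p$-happy number if $S_{e,!}^\ell(x)=p$ for some $\ell\in\mathbb{Z}_{\geq 0}$. *)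

theory Defs
  imports Main
begin

definition factoradic :: "nat \<Rightarrow> nat \<Rightarrow> (nat \<Rightarrow> nat) \<Rightarrow> bool" where
  "factoradic n k a \<longleftrightarrow>
     k \<ge> 1 \<and> a k \<noteq> 0 \<and> (\<forall>i\<in>{1..k}. a i \<le> i) \<and> n = (\<Sum>i=1..k. a i * fact i)"

lemma factoradic_exists:
  assumes "n \<ge> 1"
  shows "\<exists>k a. factoradic n k a"
proof -
  define a where "a i = n div fact i mod (Suc i)" for i
  define k where "k = Max {i. fact i \<le> n}"
  have sub: "{i. fact i \<le> n} \<subseteq> {..n}"
    using fact_ge_self le_trans by blast
  then have fin: "finite {i. fact i \<le> n}"
    using finite_subset by blast
  have one: "1 \<in> {i. fact i \<le> n}"
    using assms by simp
  have k1: "k \<ge> 1"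
    unfolding k_def using Max_ge[OF fin one] .
  have "k \<in> {i. fact i \<le> n}"
    unfolding k_def using Max_in[OF fin] one by blast
  then have le: "fact k \<le> n"
    by simp
  have lt: "n < fact (Suc k)"
  proof (rule ccontr)
    assume "\<not> n < fact (Suc k)"
    then have "Suc k \<in> {i. fact i \<le> n}"
      by simp
    then have "Suc k \<le> k"
      unfolding k_def using Max_ge[OF fin] by blast
    then show False
      by simp
  qed
  have sum: "n mod fact (Suc j) = (\<Sum>i=1..j. a i * fact i)" for j
  proof (induction j)
    case (Suc j)
    have "n mod fact (Suc (Suc j)) = n mod (fact (Suc j) * Suc (Suc j))"
      by (simp only: fact_Suc[of "Suc j"] mult.commute of_nat_id)
    also have "\<dots> = fact (Suc j) * a (Suc j) + n mod fact (Suc j)"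
      unfolding a_def by (rule mod_mult2_eq)
    also have "\<dots> = (\<Sum>i=1..Suc j. a i * fact i)"
      using Suc.IH by (simp add: mult.commute)
    finally show ?case .
  qed simp
  have "n div fact k < Suc k"
    using lt by (intro less_mult_imp_div_less) simp
  moreover have "n div fact k > 0"
    using le by (simp add: div_greater_zero_iff)
  ultimately have "a k \<noteq> 0"
    by (simp add: a_def)
  moreover have "a i \<le> i" for i
    unfolding a_def using mod_less_divisor[of "Suc i" "n div fact i"] by linarith
  moreover have "n = (\<Sum>i=1..k. a i * fact i)"
    using sum[of k] lt by simp
  ultimately show ?thesis
    using k1 unfolding factoradic_def by blast
qed

lemma factoradic_partial_sum_less:
  assumes "\<forall>i\<in>{1..k}. a i \<le> i"
  shows "(\<Sum>i=1..k. a i * fact i) < (fact (Suc k) :: nat)"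
  using assms
proof (induction k)
  case (Suc k)
  have "a (Suc k) * fact (Suc k) \<le> Suc k * (fact (Suc k) :: nat)"
    using Suc.prems by (intro mult_right_mono) auto
  moreover have "(\<Sum>i=1..k. a i * fact i) < (fact (Suc k) :: nat)"
    using Suc by simp
  moreover have "(fact (Suc (Suc k)) :: nat) = Suc k * fact (Suc k) + fact (Suc k)"
    by (simp only: fact_Suc[of "Suc k"] of_nat_id) simp
  moreover have "(\<Sum>i=1..Suc k. a i * fact i) = (\<Sum>i=1..k. a i * fact i) + a (Suc k) * fact (Suc k)"
    by simp
  ultimately show ?case
    by linarith
qed simp

lemma factoradic_bounds:
  assumes "factoradic n k a"
  shows "fact k \<le> n" "n < fact (Suc k)"
proof -
  have "1 * fact k \<le> a k * (fact k :: nat)"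
    using assms unfolding factoradic_def by (intro mult_right_mono) auto
  also have "\<dots> \<le> (\<Sum>i=1..k. a i * fact i)"
    using assms unfolding factoradic_def by (intro member_le_sum) auto
  finally show "fact k \<le> n"
    using assms unfolding factoradic_def by simp
  show "n < fact (Suc k)"
    using assms factoradic_partial_sum_less unfolding factoradic_def by blast
qed

lemma factoradic_digits_unique:
  assumes "\<forall>i\<in>{1..k}. a i \<le> i" "\<forall>i\<in>{1..k}. b i \<le> i"
    and "(\<Sum>i=1..k. a i * fact i) = (\<Sum>i=1..k. b i * (fact i :: nat))"
  shows "\<forall>i\<in>{1..k}. a i = b i"
  using assms
proof (induction k)
  case (Suc k)
  let ?A = "\<Sum>i=1..k. a i * fact i :: nat" and ?B = "\<Sum>i=1..k. b i * fact i :: nat"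
  let ?f = "fact (Suc k) :: nat"
  have A: "?A < ?f"
    using Suc.prems(1) by (intro factoradic_partial_sum_less) simp
  have B: "?B < ?f"
    using Suc.prems(2) by (intro factoradic_partial_sum_less) simp
  have eq: "?A + a (Suc k) * ?f = ?B + b (Suc k) * ?f"
    using Suc.prems(3) by simp
  have "(?A + a (Suc k) * ?f) div ?f = a (Suc k)" "(?B + b (Suc k) * ?f) div ?f = b (Suc k)"
    using div_mult_self1[of ?f ?A "a (Suc k)"] div_mult_self1[of ?f ?B "b (Suc k)"]
    by (simp_all only: div_less[OF A] div_less[OF B] fact_nonzero not_False_eq_True
        simp_thms add_0_right)
  then have top: "a (Suc k) = b (Suc k)"
    using eq by metis
  then have "\<forall>i\<in>{1..k}. a i = b i"
    using Suc.IH Suc.prems(1,2) eq unfolding top by simp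
  then show ?case
    using top by (auto simp: le_Suc_eq)
qed simp

lemma factoradic_unique:
  assumes "factoradic n k a" "factoradic n l b"
  shows "k = l" "\<forall>i\<in>{1..k}. a i = b i"
proof -
  have less: "k' < Suc l'" if "factoradic n k' a'" "factoradic n l' b'" for k' l' a' b'
  proof (rule ccontr)
    assume "\<not> k' < Suc l'"
    then have "(fact (Suc l') :: nat) \<le> fact k'"
      by (intro fact_mono) simp
    then show False
      using factoradic_bounds(1)[OF that(1)] factoradic_bounds(2)[OF that(2)] by linarith
  qed
  show kl: "k = l"
    using less[OF assms] less[OF assms(2,1)] by simp
  show "\<forall>i\<in>{1..k}. a i = b i"
    using assms kl unfolding factoradic_def by (intro factoradic_digits_unique) auto
qed

(* The description is well defined for n > 0 by factoradic_exists and factoradic_unique. It describes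
   the digit power sum rather than the digit function a, because factoradic leaves a i unconstrained
   for i outside {1..k}. *)
definition factoradic_happy_fun :: "nat \<Rightarrow> nat \<Rightarrow> nat" where
  "factoradic_happy_fun e n =
     (if n = 0 then 0 else (THE s. \<exists>k a. factoradic n k a \<and> s = (\<Sum>i=1..k. a i ^ e)))"

lemma factoradic_happy_fun_0: "factoradic_happy_fun e 0 = 0"
  by (simp add: factoradic_happy_fun_def)

lemma factoradic_happy_fun_eq:
  assumes "factoradic n k a"
  shows "factoradic_happy_fun e n = (\<Sum>i=1..k. a i ^ e)"
proof -
  have "n \<noteq> 0"
    using factoradic_bounds(1)[OF assms] by (metis fact_nonzero le_zero_eq)
  moreover have "(THE s. \<exists>k a. factoradic n k a \<and> s = (\<Sum>i=1..k. a i ^ e)) = (\<Sum>i=1..k. a i ^ e)"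
  proof (rule the_equality)
    fix s
    assume "\<exists>k a. factoradic n k a \<and> s = (\<Sum>i=1..k. a i ^ e)"
    then obtain l b where b: "factoradic n l b" "s = (\<Sum>i=1..l. b i ^ e)"
      by blast
    show "s = (\<Sum>i=1..k. a i ^ e)"
      unfolding b(2) using factoradic_unique[OF b(1) assms] by (intro sum.cong) auto
  qed (use assms in blast)
  ultimately show ?thesis
    by (simp add: factoradic_happy_fun_def)
qed

definition factoradic_fixed_point :: "nat \<Rightarrow> nat \<Rightarrow> bool" where
  "factoradic_fixed_point e p \<longleftrightarrow> p > 0 \<and> factoradic_happy_fun e p = p"

definition factoradic_happy :: "nat \<Rightarrow> nat \<Rightarrow> nat \<Rightarrow> bool" where
  "factoradic_happy e p x \<longleftrightarrow> x > 0 \<and> (\<exists>l. (factoradic_happy_fun e ^^ l) x = p)"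

end

(* Write S for the happy function. A large factorial contributes a leading digit 1, so adding a
   sum of distinct large factorials to all numbers of a finite set raises their values of S by any
   prescribed amount. Hence maps of the form "iterate S, then add a constant" can be composed into
   a single iterate of S precomposed with one translation, and it is enough to bring {0..<N}
   to a single number by alternating translations and applications of S. Two numbers at distance
   d > 0 can be brought strictly closer: some n satisfies |S (n + d) - S n| < d. For d >= 720
   take n = 0; below that, n is one of 0, 10, 37, 4267, found by computer search. *)
theory Submission
  imports Defs
begin

section \<open>Factoradic digits by division, and the digit power sum over a fixed range\<close>

definition factoradic_digit :: "nat \<Rightarrow> nat \<Rightarrow> nat" where
  "factoradic_digit n i = n div fact i mod Suc i"

lemma factoradic_digit_le: "factoradic_digit n i \<le> i"
  unfolding factoradic_digit_def using mod_less_divisor[of "Suc i" "n div fact i"] by linarith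

lemma factoradic_digit_eq_0: "n < fact i \<Longrightarrow> factoradic_digit n i = 0"
  by (simp add: factoradic_digit_def)

lemma sum_factoradic_digits:
  "(\<Sum>i=1..k. factoradic_digit n i * fact i) = n mod fact (Suc k)"
proof (induction k)
  case (Suc k)
  have "n mod fact (Suc (Suc k)) = n mod (fact (Suc k) * Suc (Suc k))"
    by (simp only: fact_Suc[of "Suc k"] mult.commute of_nat_id)
  also have "\<dots> = fact (Suc k) * factoradic_digit n (Suc k) + n mod fact (Suc k)"
    unfolding factoradic_digit_def by (rule mod_mult2_eq)
  finally show ?case
    using Suc.IH by (simp add: mult.commute)
qed simp

text \<open>The range may extend past the leading digit: the digits there are 0, and
  \<open>e \<ge> 1\<close> makes \<open>0 ^ e\<close> vanish.\<close>

lemma happy_fun_eq_sum_digits: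
  assumes "e \<ge> 1" "n < fact (Suc k)"
  shows "factoradic_happy_fun e n = (\<Sum>i=1..k. factoradic_digit n i ^ e)"
proof (cases "n = 0")
  case True
  then show ?thesis
    using assms(1) by (simp add: factoradic_happy_fun_0 factoradic_digit_eq_0)
next
  case False
  then obtain l a where l: "factoradic n l a"
    using factoradic_exists[of n] by auto
  note b = factoradic_bounds[OF l]
  have "n div fact l < Suc l"
    using b(2) by (intro less_mult_imp_div_less) simp
  moreover have "n div fact l > 0"
    using b(1) by (simp add: div_greater_zero_iff)
  ultimately have "factoradic_digit n l \<noteq> 0"
    by (simp add: factoradic_digit_def)
  then have "factoradic n l (factoradic_digit n)"
    using l b(2) sum_factoradic_digits[of n l] factoradic_digit_le
    unfolding factoradic_def by simp
  then have *: "factoradic_happy_fun e n = (\<Sum>i=1..l. factoradic_digit n i ^ e)"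
    by (rule factoradic_happy_fun_eq)
  have "fact l < (fact (Suc k) :: nat)"
    using b(1) assms(2) by linarith
  then have "l \<le> k"
    by (metis fact_mono_nat not_less not_less_eq_eq)
  moreover have "factoradic_digit n i = 0" if "l < i" for i
    using that b(2) fact_mono_nat[of "Suc l" i]
    by (intro factoradic_digit_eq_0) linarith
  ultimately show ?thesis
    unfolding * using assms(1) by (intro sum.mono_neutral_left) auto
qed

text \<open>Carries upper bounds for exponents 3 and 4 over to the smaller exponents.\<close>

lemma happy_fun_mono_exponent:
  assumes "1 \<le> e" "e \<le> e'"
  shows "factoradic_happy_fun e n \<le> factoradic_happy_fun e' n"
proof -
  obtain k where k: "n < fact (Suc k)"
    using fact_ge_self[of "Suc n"] by (auto simp: Suc_le_eq)
  have "x ^ e \<le> x ^ e'" for x :: nat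
    using assms by (cases "x = 0") (auto simp: power_0_left intro: power_increasing)
  then show ?thesis
    using assms k happy_fun_eq_sum_digits[of e n k] happy_fun_eq_sum_digits[of e' n k]
    by (simp add: sum_mono)
qed

section \<open>Translations by sums of large factorials\<close>

text \<open>Position \<open>k\<close> of \<open>n\<close> is empty and receives the digit 1. Lower
  digits are kept, because \<open>fact k\<close> is a multiple of \<open>fact (Suc i)\<close> for
  \<open>i < k\<close>.\<close>

lemma happy_fun_add_fact:
  assumes "e \<ge> 1" "k \<ge> 1" "n < fact k"
  shows "factoradic_happy_fun e (n + fact k) = factoradic_happy_fun e n + 1"
proof -
  obtain j where k: "k = Suc j"
    using assms(2) by (cases k) auto
  have "fact k + fact k \<le> (fact (Suc k) :: nat)"
    using assms(2) mult_le_mono1[of 2 "Suc k" "fact k"] by simp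
  then have less: "n + fact k < fact (Suc k)"
    using assms(3) by linarith
  have "(n + fact k) div fact k = 1"
    using div_add_self2[of "fact k" n] assms(3) by simp
  then have top: "factoradic_digit (n + fact k) k = 1"
    using assms(2) by (simp add: factoradic_digit_def)
  have low: "factoradic_digit (n + fact k) i = factoradic_digit n i" if "i \<in> {1..j}" for i
  proof -
    have "fact (Suc i) dvd (fact k :: nat)"
      using that k by (intro fact_dvd) auto
    then obtain q where q: "fact k = fact (Suc i) * (q :: nat)"
      by (auto elim: dvdE)
    have "(n + fact k) div fact i = n div fact i + Suc i * q"
      unfolding q using div_mult_self2[of "fact i" n "Suc i * q"] by (simp add: algebra_simps)
    then show ?thesis
      by (simp only: factoradic_digit_def mod_mult_self2)
  qed
  have "factoradic_happy_fun e (n + fact k) = (\<Sum>i=1..k. factoradic_digit (n + fact k) i ^ e)"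
    using happy_fun_eq_sum_digits assms(1) less by blast
  also have "\<dots> = (\<Sum>i=1..j. factoradic_digit n i ^ e) + 1"
    using top low by (simp add: k)
  also have "(\<Sum>i=1..j. factoradic_digit n i ^ e) = factoradic_happy_fun e n"
    using happy_fun_eq_sum_digits[of e n j] assms k by simp
  finally show ?thesis .
qed

lemma exists_fact_greater: "\<exists>k\<ge>1. (n :: nat) < fact k"
  using fact_ge_self[of "Suc n"] by (intro exI[of _ "Suc n"]) auto

text \<open>Each unit of \<open>v\<close> costs one factorial above \<open>B + h\<close>, which
  works for all \<open>t \<le> B\<close> at once.\<close>

lemma happy_fun_shift:
  assumes "e \<ge> 1"
  shows "\<exists>h. \<forall>t\<le>B. factoradic_happy_fun e (t + h) = factoradic_happy_fun e t + v"
proof (induction v)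
  case (Suc v)
  then obtain h where h: "\<forall>t\<le>B. factoradic_happy_fun e (t + h) = factoradic_happy_fun e t + v"
    by blast
  obtain k where k: "k \<ge> 1" "B + h < fact k"
    using exists_fact_greater by blast
  have "factoradic_happy_fun e (t + (h + fact k)) = factoradic_happy_fun e t + Suc v" if "t \<le> B" for t
    using happy_fun_add_fact[OF assms k(1), of "t + h"] k(2) h that by (simp add: add.assoc)
  then show ?case
    by blast
qed (auto intro: exI[of _ 0])

lemma happy_fun_funpow_shift:
  assumes "e \<ge> 1"
  shows "\<exists>h. \<forall>t\<le>B. (factoradic_happy_fun e ^^ l) (t + h) = (factoradic_happy_fun e ^^ l) t + v"
proof (induction l arbitrary: B v)
  case (Suc l)
  let ?S = "factoradic_happy_fun e"
  \<comment> \<open>The last \<open>l\<close> iterations act on values of the first one, so the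
    induction hypothesis is needed up to \<open>C\<close>; the translation \<open>w\<close> that it
    demands is produced by the first application.\<close>
  define C where "C = Max (?S ` {..B})"
  have C: "?S t \<le> C" if "t \<le> B" for t
    unfolding C_def using that by (intro Max_ge) auto
  obtain w where w: "\<forall>t\<le>C. (?S ^^ l) (t + w) = (?S ^^ l) t + v"
    using Suc.IH by blast
  obtain h where "\<forall>t\<le>B. ?S (t + h) = ?S t + w"
    using happy_fun_shift[OF assms] by blast
  then show ?case
    using w C by (intro exI[of _ h]) (simp add: funpow_swap1[symmetric] funpow_Suc_right del: funpow.simps)
qed auto

text \<open>Once \<open>v - 1\<close> is attained at some \<open>h\<close>, a factorial above
  \<open>h + M\<close> supplies the last unit and lifts the argument beyond
  \<open>M\<close>.\<close>

lemma happy_fun_surj_above: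
  assumes "e \<ge> 1" "v > 0"
  shows "\<exists>n\<ge>M. factoradic_happy_fun e n = v"
proof -
  obtain h where h: "factoradic_happy_fun e h = v - 1"
    using happy_fun_shift[OF assms(1), of 0 "v - 1"] by (auto simp: factoradic_happy_fun_0)
  obtain k where k: "k \<ge> 1" "h + M < fact k"
    using exists_fact_greater by blast
  then show ?thesis
    using happy_fun_add_fact[OF assms(1) k(1), of h] h assms(2)
    by (intro exI[of _ "h + fact k"]) auto
qed

section \<open>Decrease of the function for exponent 4 from 720 on\<close>

lemma fact_ge_three_cubes: "6 \<le> i \<Longrightarrow> 3 * i ^ 3 \<le> (fact i :: nat)"
proof (induction i rule: dec_induct)
  case base
  then show ?case by (simp add: fact_numeral)
next
  case (step i)
  have "(Suc i)\<^sup>2 \<le> (2 * i)\<^sup>2"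
    using step by (intro power_mono) auto
  also have "\<dots> = 4 * i\<^sup>2"
    by (simp add: power_mult_distrib)
  also have "\<dots> \<le> i * i\<^sup>2"
    using step by (intro mult_right_mono) auto
  also have "\<dots> = i ^ 3"
    by (simp add: power2_eq_square power3_eq_cube)
  finally have "3 * (Suc i)\<^sup>2 \<le> fact i"
    using step.IH by linarith
  then have "Suc i * (3 * (Suc i)\<^sup>2) \<le> Suc i * fact i"
    by (rule mult_le_mono2)
  then show ?case
    by (simp only: fact_Suc of_nat_id power2_eq_square power3_eq_cube mult.left_commute)
qed

text \<open>Digits from position 6 on contribute at most a third of their part of \<open>d\<close>.
  That part is at least 720, so at least 480 is saved, while positions 1 to 5 lose at most
  260.\<close>

lemma happy_fun_4_less:
  assumes "720 \<le> d"
  shows "factoradic_happy_fun 4 d < d"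
proof -
  obtain k where k: "k \<ge> 1" "d < fact k"
    using exists_fact_greater by blast
  define a where "a = factoradic_digit d"
  have "(720 :: nat) = fact 6" by (simp add: fact_numeral)
  then have "\<not> k \<le> 6"
    using k assms fact_mono_nat[of k 6] by linarith
  then have split: "{1..k} = {1..5} \<union> {6..k}" and disj: "{1..5} \<inter> {6..k} = {}" by auto
  have dk: "d < fact (Suc k)"
    using k fact_mono_nat[of k "Suc k"] by linarith
  have le: "a i \<le> i" for i
    by (simp add: a_def factoradic_digit_le)
  have S: "factoradic_happy_fun 4 d = (\<Sum>i=1..5. a i ^ 4) + (\<Sum>i=6..k. a i ^ 4)"
    using happy_fun_eq_sum_digits[of 4 d k] assms dk
    unfolding a_def[symmetric] split by (subst (asm) sum.union_disjoint) (auto simp: disj)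
  have r: "d mod 720 = (\<Sum>i=1..5. a i * fact i)"
    unfolding a_def using sum_factoradic_digits[of d 5] by (simp add: fact_numeral)
  have d: "d = (\<Sum>i=1..5. a i * fact i) + (\<Sum>i=6..k. a i * fact i)"
    using sum_factoradic_digits[of d k] dk
    unfolding a_def[symmetric] split by (subst (asm) sum.union_disjoint) (auto simp: disj)
  have "3 * (\<Sum>i=6..k. a i ^ 4) \<le> (\<Sum>i=6..k. a i * fact i)"
    unfolding sum_distrib_left
  proof (rule sum_mono)
    fix i assume i: "i \<in> {6..k}"
    have "3 * a i ^ 4 = a i * (3 * a i ^ 3)"
      by (simp add: power3_eq_cube power4_eq_xxxx)
    also have "\<dots> \<le> a i * (3 * i ^ 3)"
      using le[of i] by (intro mult_left_mono power_mono) auto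
    also have "\<dots> \<le> a i * fact i"
      using fact_ge_three_cubes[of i] i by (intro mult_left_mono) auto
    finally show "3 * a i ^ 4 \<le> a i * fact i" .
  qed
  \<comment> \<open>The losses are greatest at the maximal digits: 0 + 12 + 63 + 160 + 25 =
    260.\<close>
  moreover have "(\<Sum>i=1..5. a i ^ 4) \<le> (\<Sum>i=1..5. a i * fact i) + 260"
  proof -
    have "a 1 ^ 4 \<le> a 1"
      using le[of 1] by (cases "a 1") auto
    moreover have "a 2 ^ 4 \<le> a 2 * 2 + 12"
    proof -
      have "a 2 \<in> {0, 1, 2}" using le[of 2] by auto
      then show ?thesis by auto
    qed
    moreover have "a 3 ^ 4 \<le> a 3 * 6 + 63"
    proof -
      have "a 3 \<in> {0, 1, 2, 3}" using le[of 3] by auto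
      then show ?thesis by auto
    qed
    moreover have "a 4 ^ 4 \<le> a 4 * 24 + 160"
    proof -
      have "a 4 \<in> {0, 1, 2, 3, 4}" using le[of 4] by auto
      then show ?thesis by auto
    qed
    moreover have "a 5 ^ 4 \<le> a 5 * 120 + 25"
    proof -
      have "a 5 \<in> {0, 1, 2, 3, 4, 5}" using le[of 5] by auto
      then show ?thesis by auto
    qed
    moreover have "{1..5} = {1, 2, 3, 4, 5 :: nat}" by auto
    ultimately show ?thesis
      by (simp add: fact_numeral)
  qed
  moreover have "(\<Sum>i=6..k. a i * fact i) \<ge> 720"
  proof -
    have "d = d mod 720 + 720 * (d div 720)" by simp
    moreover have "d div 720 \<ge> 1" using assms by (simp add: div_greater_zero_iff Suc_le_eq)
    ultimately show ?thesis using d r by linarith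
  qed
  ultimately show ?thesis
    using S d by linarith
qed

section \<open>Contraction of distances, with a finite computation below 720\<close>

text \<open>Six digits suffice below \<open>fact 7 = 5040\<close>, which covers every tested
  \<open>n + d \<le> 4267 + 719\<close>; explicit numerals let the simplifier evaluate it.\<close>

definition happy_fun_5040 :: "nat \<Rightarrow> nat \<Rightarrow> nat" where
  "happy_fun_5040 e n = (n mod 2) ^ e + (n div 2 mod 3) ^ e + (n div 6 mod 4) ^ e
     + (n div 24 mod 5) ^ e + (n div 120 mod 6) ^ e + (n div 720 mod 7) ^ e"

lemma happy_fun_eq_5040:
  assumes "e \<ge> 1" "n < 5040"
  shows "factoradic_happy_fun e n = happy_fun_5040 e n"
proof -
  have digits: "factoradic_digit n 1 = n mod 2" "factoradic_digit n 2 = n div 2 mod 3"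
    "factoradic_digit n 3 = n div 6 mod 4" "factoradic_digit n 4 = n div 24 mod 5"
    "factoradic_digit n 5 = n div 120 mod 6" "factoradic_digit n 6 = n div 720 mod 7"
    by (simp_all add: factoradic_digit_def fact_numeral numeral_2_eq_2[symmetric])
  have "{1..6} = {1, 2, 3, 4, 5, 6 :: nat}"
    by auto
  moreover have "n < fact (Suc 6)"
    using assms(2) by (simp add: fact_numeral)
  ultimately have "factoradic_happy_fun e n = (\<Sum>i\<in>{1, 2, 3, 4, 5, 6}. factoradic_digit n i ^ e)"
    using happy_fun_eq_sum_digits assms(1) by metis
  also have "\<dots> = happy_fun_5040 e n"
    by (simp add: happy_fun_5040_def digits[unfolded One_nat_def] digits)
  finally show ?thesis .
qed

text \<open>Two inequalities express an absolute difference below \<open>d\<close> without truncated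
  subtraction.\<close>

definition contracts_at :: "nat \<Rightarrow> nat \<Rightarrow> nat \<Rightarrow> bool" where
  "contracts_at e d n \<longleftrightarrow> happy_fun_5040 e (n + d) < d + happy_fun_5040 e n \<and>
     happy_fun_5040 e n < d + happy_fun_5040 e (n + d)"

(* Nested conditionals rather than disjunctions, because the simplifier then evaluates an
   alternative only after the previous one has failed. *)
lemma contracts_at_small:
  "\<forall>e\<in>{1, 2, 3, 4}. \<forall>d\<in>set (1 # [2..<24]).
     if happy_fun_5040 e d < d then True else
     if contracts_at e d 4267 then True else
     if contracts_at e d 10 then True else contracts_at e d 37"
  by (simp add: happy_fun_5040_def contracts_at_def cong: if_weak_cong)

text \<open>By monotonicity in the exponent, the test for exponent 3 also settles 1 and 2, so only
  exponent 4 can require a nonzero \<open>n\<close>.\<close>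

lemma contracts_at_large:
  "\<forall>d\<in>set [24..<720].
     if happy_fun_5040 4 d < d then True else
     if happy_fun_5040 3 d < d then
       if contracts_at 4 d 4267 then True else
       if contracts_at 4 d 10 then True else contracts_at 4 d 37
     else False"
  by (simp add: happy_fun_5040_def contracts_at_def cong: if_weak_cong)

lemma happy_fun_contracts:
  assumes "e \<in> {1, 2, 3, 4}" "d \<ge> 1"
  shows "\<exists>n. factoradic_happy_fun e (n + d) < d + factoradic_happy_fun e n \<and>
     factoradic_happy_fun e n < d + factoradic_happy_fun e (n + d)"
proof -
  let ?S = factoradic_happy_fun
  have e: "e \<ge> 1" using assms(1) by auto
  \<comment> \<open>The first alternative is contraction at \<open>n = 0\<close>, where the function
    vanishes.\<close>
  have "?S e d < d \<or> (d < 720 \<and> (\<exists>n\<in>{10, 37, 4267}. contracts_at e d n))"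
  proof -
    consider "d < 24" | "24 \<le> d" "d < 720" | "720 \<le> d" by linarith
    then show ?thesis
    proof cases
      case 1
      then have "d \<in> set (1 # [2..<24])"
        unfolding list.set set_upt using assms(2) by auto
      then show ?thesis
        using 1 contracts_at_small[THEN bspec, of e, THEN bspec, of d] assms(1) e happy_fun_eq_5040[of e d]
        by (auto split: if_splits)
    next
      case 2
      have d: "d \<in> set [24..<720]"
        unfolding set_upt using 2 by simp
      have eq: "?S 4 d = happy_fun_5040 4 d" "?S 3 d = happy_fun_5040 3 d"
        using 2 by (simp_all add: happy_fun_eq_5040)
      have table: "?S 4 d < d \<or> (?S 3 d < d \<and> (\<exists>n\<in>{10, 37, 4267}. contracts_at 4 d n))"
        using contracts_at_large[THEN bspec, OF d] unfolding eq by (auto split: if_splits)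
      show ?thesis
      proof (cases "e = 4")
        case True
        then show ?thesis using table 2 by blast
      next
        case False
        then have "?S e d \<le> ?S 3 d" "?S 3 d \<le> ?S 4 d"
          using assms(1) by (auto intro: happy_fun_mono_exponent)
        then show ?thesis using table by linarith
      qed
    next
      case 3
      then show ?thesis
        using happy_fun_4_less[of d] happy_fun_mono_exponent[of e 4 d] assms(1) by auto
    qed
  qed
  then show ?thesis
  proof
    assume "?S e d < d"
    then show ?thesis
      using assms(2) by (intro exI[of _ 0]) (auto simp: factoradic_happy_fun_0)
  next
    assume "d < 720 \<and> (\<exists>n\<in>{10, 37, 4267}. contracts_at e d n)"
    then obtain n where n: "d < 720" "n \<in> {10, 37, 4267}" "contracts_at e d n"
      by blast
    then have "n + d < 5040" by auto
    then show ?thesis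
      using n(3) e happy_fun_eq_5040[of e n] happy_fun_eq_5040[of e "n + d"]
      unfolding contracts_at_def by (intro exI[of _ n]) simp
  qed
qed

section \<open>Merging finitely many numbers into one value\<close>

text \<open>Strong induction on the distance: translate the pair to a place where one application
  brings it closer, then merge the images.\<close>

lemma happy_fun_merge_pair:
  assumes "e \<in> {1, 2, 3, 4}"
  shows "\<exists>h l. (factoradic_happy_fun e ^^ l) (s + h) = (factoradic_happy_fun e ^^ l) (t + h)"
proof -
  let ?S = "factoradic_happy_fun e"
  have e: "e \<ge> 1" using assms by auto
  have *: "\<exists>h l. (?S ^^ l) (s + h) = (?S ^^ l) (s + d + h)" for s d
  proof (induction d arbitrary: s rule: less_induct)
    case (less d)
    show ?case
    proof (cases "d = 0")
      case False
      then obtain n where n: "?S (n + d) < d + ?S n" "?S n < d + ?S (n + d)"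
        using happy_fun_contracts[OF assms, of d] by auto
      obtain k where k: "k \<ge> 1" "n + d + s < fact k"
        using exists_fact_greater by blast
      \<comment> \<open>A translation cannot lower \<open>s\<close> to \<open>n\<close>, so the
        target is \<open>n + fact k\<close>; the extra factorial adds 1 to both images and keeps
        their distance.\<close>
      define g where "g = n + fact k - s"
      have g: "s + g = n + fact k" "s + d + g = (n + d) + fact k"
        using k(2) by (auto simp: g_def)
      have Sg: "?S (s + g) = ?S n + 1" "?S (s + d + g) = ?S (n + d) + 1"
        unfolding g using k by (intro happy_fun_add_fact e; simp)+
      have "\<exists>h l. (?S ^^ l) (?S (s + g) + h) = (?S ^^ l) (?S (s + d + g) + h)"
      \<comment> \<open>The images may come in either order, whereas the induction hypothesis starts
        from the smaller one.\<close>
      proof (cases "?S (s + g) \<le> ?S (s + d + g)")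
        case True
        then show ?thesis
          using less.IH[of "?S (s + d + g) - ?S (s + g)" "?S (s + g)"] n Sg by auto
      next
        case False
        then have "?S (s + d + g) + (?S (s + g) - ?S (s + d + g)) = ?S (s + g)"
          by simp
        moreover have "?S (s + g) - ?S (s + d + g) < d"
          using False n Sg by linarith
        ultimately show ?thesis
          using less.IH by metis
      qed
      then obtain h l where hl: "(?S ^^ l) (?S (s + g) + h) = (?S ^^ l) (?S (s + d + g) + h)"
        by blast
      obtain h' where h': "\<forall>t\<le>s + d + g. ?S (t + h') = ?S t + h"
        using happy_fun_shift[OF e] by blast
      have "(?S ^^ Suc l) (s + (g + h')) = (?S ^^ Suc l) (s + d + (g + h'))"
        using hl h' by (simp add: funpow_Suc_right add.assoc[symmetric] del: funpow.simps)
      then show ?thesis by blast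
    qed auto
  qed
  show ?thesis
  proof (cases "s \<le> t")
    case True
    then show ?thesis using *[of s "t - s"] by simp
  next
    case False
    then show ?thesis using *[of t "s - t"] by (simp add: eq_commute)
  qed
qed

lemma happy_fun_merge:
  assumes "e \<in> {1, 2, 3, 4}"
  shows "\<exists>h l v. \<forall>t<N. (factoradic_happy_fun e ^^ l) (t + h) = v"
proof (induction N)
  case (Suc N)
  let ?S = "factoradic_happy_fun e"
  have e: "e \<ge> 1" using assms by auto
  obtain h l v where v: "\<forall>t<N. (?S ^^ l) (t + h) = v"
    using Suc.IH by blast
  obtain g m where m: "(?S ^^ m) (v + g) = (?S ^^ m) ((?S ^^ l) (N + h) + g)"
    using happy_fun_merge_pair[OF assms] by blast
  \<comment> \<open>Realises the translation by \<open>g\<close> between the first \<open>l\<close>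
    and the last \<open>m\<close> iterations as a translation of the input.\<close>
  obtain h' where h': "\<forall>t\<le>N + h. (?S ^^ l) (t + h') = (?S ^^ l) t + g"
    using happy_fun_funpow_shift[OF e] by blast
  have "(?S ^^ (m + l)) (t + (h + h')) = (?S ^^ m) (v + g)" if "t < Suc N" for t
  proof -
    have "(?S ^^ l) (t + (h + h')) = (?S ^^ l) (t + h) + g"
      using h' that by (simp add: add.assoc[symmetric])
    then show ?thesis
      using v m that by (cases "t = N") (auto simp: funpow_add)
  qed
  then show ?case by blast
qed auto

theorem theorem1p4:
  fixes e p :: nat
  assumes "e \<in> {1, 2, 3, 4}"
    and "factoradic_fixed_point e p"
  shows "\<forall>N::nat. \<exists>m::nat. \<forall>j<N. factoradic_happy e p (m + j)"
proof
  fix N :: nat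
  let ?S = "factoradic_happy_fun e"
  have e: "e \<ge> 1" using assms by auto
  have p: "p > 0" using assms(2) by (simp add: factoradic_fixed_point_def)
  obtain h l v where v: "\<forall>t<N. (?S ^^ l) (t + h) = v"
    using happy_fun_merge[OF assms(1)] by blast
  \<comment> \<open>A preimage of \<open>p\<close> that is at least \<open>v\<close> can be reached
    from the common value \<open>v\<close> by adding \<open>n - v\<close>.\<close>
  obtain n where n: "n \<ge> v" "?S n = p"
    using happy_fun_surj_above[OF e p] by blast
  obtain h' where h': "\<forall>t\<le>N + h. (?S ^^ l) (t + h') = (?S ^^ l) t + (n - v)"
    using happy_fun_funpow_shift[OF e] by blast
  have "factoradic_happy e p (h + h' + j)" if "j < N" for j
  proof -
    have "(?S ^^ l) (j + h + h') = (?S ^^ l) (j + h) + (n - v)" "(?S ^^ l) (j + h) = v"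
      using h' v that by auto
    then have "(?S ^^ l) (h + h' + j) = n"
      using n(1) by (simp add: ac_simps)
    then have *: "(?S ^^ Suc l) (h + h' + j) = p"
      using n(2) by simp
    \<comment> \<open>Positivity: the orbit of 0 never reaches \<open>p > 0\<close>.\<close>
    have "(?S ^^ i) 0 = 0" for i
      by (induction i) (simp_all add: factoradic_happy_fun_0)
    then have "h + h' + j > 0"
      using * p by (metis gr0I less_numeral_extra(3))
    then show ?thesis
      unfolding factoradic_happy_def using * by blast
  qed
  then show "\<exists>m. \<forall>j<N. factoradic_happy e p (m + j)" by blast
qed

end
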